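(* Let $q\in(0,1)$ and $\phi(q)=-\log(1-q)$. For positive integers $n,c$ let $Y_1^{(c)},\ldots,Y_n^{(c)}$ be i.i.d. $\mathrm{NegBin}(c,q)$ and $Y_{n:n}^{(c)}=\max_jY_j^{(c)}$. Let $Q(c,x)=\Gamma(c,x)/\Gamma(c)$. Then for all positive integers $n,c$, $$\frac{1}{\phi(q)}\tilde l(n,c)\le\frac{\mathbb{E}[Y_{n:n}^{(c)}]}{c}\le\frac1{\phi(q)}\,n\,Q\bigl(c+1,Q^{-1}(c,\tfrac1n)\bigr)+1\le\frac1{\phi(q)}\tilde u(n,c)+1,$$ where $$\tilde l(n,c)=1+\sqrt{\frac{\log n}{c}}\Bigl(1-\bigl(1-Q(c,c+\sqrt{c\log n})\bigr)^{n-1}\Bigr),\qquad\tilde u(n,c)=1+\frac{n}{\sqrt{2\pi c}}.$$ Moreover, for every fixed $n$, $\lim_{c\to\infty}\tilde l(n,c)=\lim_{c\to\infty}\tilde u(n,c)=1$.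
   Context: $\mathrm{NegBin}(c,q)$ is the law of the sum of $c$ independent geometric random variables on $\{1,2,\ldots\}$ with success probability $q$. $\Gamma(c,x)=\int_x^\infty t^{c-1}e^{-t}dt$, so $Q(c,\cdot)$ is the complementary CDF of the $\mathrm{Gamma}(c,1)$ distribution; $Q^{-1}(c,\cdot)$ is the inverse of $x\mapsto Q(c,x)$ on $[0,\infty)$. *)

theory Defs
  imports "HOL-Probability.Probability"
begin

text \<open>
  The library's \<open>geometric_pmf q\<close> counts failures and lives on \<open>{0, 1, \<dots>}\<close>; composing with
  \<open>Suc\<close> gives the geometric law on \<open>{1, 2, \<dots>}\<close>, i.e. the number of trials. The resulting
  negative binomial law lives on \<open>{c, c + 1, \<dots>}\<close> and hence differs from the library's
  \<open>neg_binomial_pmf c q\<close>, which counts failures, by a shift of \<open>c\<close>.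
\<close>

definition NegBin :: "nat \<Rightarrow> real \<Rightarrow> nat pmf" where
  "NegBin c q =
     map_pmf (\<lambda>g. \<Sum>i<c. g i) (Pi_pmf {..<c} 0 (\<lambda>_. map_pmf Suc (geometric_pmf q)))"

definition upper_Gamma :: "real \<Rightarrow> real \<Rightarrow> real" where
  "upper_Gamma c x = (LBINT t:{x..}. t powr (c - 1) * exp (- t))"

definition Q :: "real \<Rightarrow> real \<Rightarrow> real" where
  "Q c x = upper_Gamma c x / Gamma c"

text \<open>
  As an inverse on \<open>[0,\<infinity>)\<close>, this is meaningful for arguments in \<open>(0,1]\<close> only.
\<close>

definition Q_inv :: "real \<Rightarrow> real \<Rightarrow> real" where
  "Q_inv c = the_inv_into {0..} (Q c)"

definition phi :: "real \<Rightarrow> real" where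
  "phi q = - ln (1 - q)"

definition l_tilde :: "nat \<Rightarrow> nat \<Rightarrow> real" where
  "l_tilde n c =
     1 + sqrt (ln (real n) / real c) *
         (1 - (1 - Q (real c) (real c + sqrt (real c * ln (real n)))) ^ (n - 1))"

definition u_tilde :: "nat \<Rightarrow> nat \<Rightarrow> real" where
  "u_tilde n c = 1 + real n / sqrt (2 * pi * real c)"

end

theory Submission
  imports Defs "HOL-Real_Asymp.Real_Asymp"
begin

text \<open>
  A geometric variable is one plus the integer part of an exponential variable of rate \<open>phi q\<close>.
  Hence a \<open>NegBin c q\<close> variable lies between \<open>G / phi q\<close> and \<open>G / phi q + c\<close>, where \<open>G\<close> has the
  Gamma distribution with parameters \<open>c\<close> and \<open>1\<close>.

  Lower bound: for \<open>t = c + sqrt (c * ln n)\<close>, bound the maximum from below by \<open>t / phi q\<close> if one of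
  the first \<open>n - 1\<close> variables reaches this level, and by the independent last variable otherwise.

  Upper bound: the maximum is at most \<open>s\<close> plus the sum of the positive parts of \<open>Y j - s\<close>. For
  \<open>s = c + x / phi q\<close> these have expectation at most
  \<open>(c * Q (c + 1) x - x * Q c x) / phi q\<close>, and the choice \<open>Q c x = 1 / n\<close> cancels the terms in \<open>x\<close>.
  The last inequality follows from \<open>Q (c + 1) x = Q c x + exp (- x) * x ^ c / fact c\<close>, where the
  second term is maximal at \<open>x = c\<close>, and from Stirling's lower bound for \<open>fact c\<close>.
\<close>

section \<open>Stirling's lower bound\<close>

text \<open>The logarithm of \<open>fact n / (n powr (n + 1/2) * exp (- n))\<close>. It decreases to
  \<open>ln (2 * pi) / 2\<close>, and that is Stirling's lower bound.\<close>

definition stirling_seq :: "nat \<Rightarrow> real" where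
  "stirling_seq n = ln (fact n) - (real n + 1/2) * ln (real n) + real n"

lemma stirling_seq_diff:
  assumes "n > 0"
  shows "stirling_seq n - stirling_seq (Suc n) = (real n + 1/2) * (ln (real n + 1) - ln (real n)) - 1"
proof -
  have "ln (fact (Suc n) :: real) = ln (real n + 1) + ln (fact n)"
    using assms by (simp add: ln_mult add.commute)
  then show ?thesis
    by (simp add: stirling_seq_def algebra_simps)
qed

text \<open>The difference of logarithms is the integral of 1/t over [n, n+1]. By convexity it is at
  least the midpoint value 1/(n + 1/2), which balances the constant 1 in
  \<open>stirling_seq_diff\<close>.\<close>

lemma stirling_seq_Suc_le:
  assumes "n > 0"
  shows "stirling_seq (Suc n) \<le> stirling_seq n"
proof -
  have "ln (real n + 1) - ln (real n) \<ge> 2 * (real n + 1 - real n) / (real n + (real n + 1))"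
    using assms by (intro ln_inverse_approx_ge) auto
  then have "(real n + 1/2) * (ln (real n + 1) - ln (real n)) \<ge> (real n + 1/2) * (2 / (2 * real n + 1))"
    by (intro mult_left_mono) auto
  also have "(real n + 1/2) * (2 / (2 * real n + 1)) = 1"
    by (simp add: field_simps)
  finally show ?thesis
    using stirling_seq_diff[OF assms] by simp
qed

text \<open>The trapezoidal upper bound for the same integral leaves the error 1/(4n(n+1)) = 1/(4n)
  - 1/(4(n+1)), so the correction term telescopes.\<close>

lemma stirling_seq_Suc_ge:
  assumes "n > 0"
  shows "stirling_seq n - 1 / (4 * real n) \<le> stirling_seq (Suc n) - 1 / (4 * real (Suc n))"
proof -
  have "ln (real n + 1) - ln (real n) \<le> 1 * (inverse (real n) + inverse (real n + 1)) / 2"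
    using assms by (intro ln_inverse_approx_le) auto
  then have "(real n + 1/2) * (ln (real n + 1) - ln (real n))
      \<le> (real n + 1/2) * (1 * (inverse (real n) + inverse (real n + 1)) / 2)"
    by (intro mult_left_mono) auto
  also have "\<dots> = 1 + 1 / (4 * real n) - 1 / (4 * real (Suc n))"
    using assms by (simp add: divide_simps) (simp add: algebra_simps)
  finally show ?thesis
    using stirling_seq_diff[OF assms] by simp
qed

lemma stirling_seq_decseq: "decseq (\<lambda>n. stirling_seq (Suc n))"
  by (intro decseq_SucI stirling_seq_Suc_le) auto

text \<open>The corrected sequence increases and starts at 1 - 1/4. This crude bound serves only to
  make the decreasing sequence converge.\<close>

lemma stirling_seq_lower: "stirling_seq (Suc n) \<ge> 3 / 4"
proof -
  have "incseq (\<lambda>n. stirling_seq (Suc n) - 1 / (4 * real (Suc n)))"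
    by (intro incseq_SucI stirling_seq_Suc_ge) auto
  from incseqD[OF this, of 0 n] have "3 / 4 \<le> stirling_seq (Suc n) - 1 / (4 * real (Suc n))"
    by (simp add: stirling_seq_def)
  then show ?thesis
    by (smt (verit) divide_nonneg_nonneg of_nat_0_le_iff)
qed

section \<open>Identification of Stirling's constant by Wallis' product\<close>

lemma wallis_prod_fact:
  "(\<Prod>k=1..n. (4*real k^2) / (4*real k^2 - 1)) = 16 ^ n * fact n ^ 4 / (fact (2 * n) ^ 2 * (2 * real n + 1))"
proof (induction n)
  case (Suc n)
  \<comment> \<open>The induction step as a purely rational identity, with A = 16^n, F = n!, G =
    (2n)!, x = n+1, b = 2n+1 and d = 2n+3. Abstracting the factorials keeps the simplifier from
    unfolding them.\<close>
  have *: "A * F ^ 4 / (G\<^sup>2 * b) * (4 * x\<^sup>2 / (b * d)) = 16 * A * (x * F) ^ 4 / ((2 * x * b * G)\<^sup>2 * d)"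
    if "x \<noteq> 0" "G \<noteq> 0" "b \<noteq> 0" "d \<noteq> 0" for A F G b d x :: real
    using that by (simp add: divide_simps power_mult_distrib power2_eq_square power4_eq_xxxx)
  have "(\<Prod>k=1..Suc n. (4*real k^2) / (4*real k^2 - 1))
      = 16 ^ n * fact n ^ 4 / ((fact (2 * n))\<^sup>2 * (2 * real n + 1)) *
          (4 * (real n + 1)\<^sup>2 / ((2 * real n + 1) * (2 * real n + 3)))"
    using Suc by (simp add: power2_eq_square algebra_simps)
  also have "\<dots> = 16 * 16 ^ n * ((real n + 1) * fact n) ^ 4 /
      ((2 * (real n + 1) * (2 * real n + 1) * fact (2 * n))\<^sup>2 * (2 * real n + 3))"
    by (intro *) auto
  also have "2 * (real n + 1) * (2 * real n + 1) * fact (2 * n) = fact (2 * Suc n)"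
    by (simp add: algebra_simps)
  also have "(real n + 1) * fact n = fact (Suc n)"
    by (simp add: algebra_simps)
  finally show ?case
    by (simp add: algebra_simps)
qed auto

text \<open>In \<open>4 * stirling_seq n - 2 * stirling_seq (2 * n)\<close> the linear terms and
  those in \<open>n * ln n\<close> cancel. Only terms with known limits remain besides the Stirling
  sequence.\<close>

lemma ln_wallis_prod:
  assumes "n > 0"
  shows "ln (\<Prod>k=1..n. (4*real k^2) / (4*real k^2 - 1))
       = 4 * stirling_seq n - 2 * stirling_seq (2 * n) - ln 2 - ln (2 + 1 / real n)"
proof -
  have "2 + 1 / real n = (2 * real n + 1) / real n"
    using assms by (simp add: field_simps)
  then have 1: "ln (2 + 1 / real n) = ln (2 * real n + 1) - ln (real n)"
    using assms by (simp add: ln_div)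
  have "ln (16::real) = ln (2 ^ 4)"
    by simp
  then have 2: "ln (16::real) = 4 * ln 2"
    by (simp only: ln_realpow)
  have "ln (\<Prod>k=1..n. (4*real k^2) / (4*real k^2 - 1))
      = real n * ln 16 + 4 * ln (fact n) - (2 * ln (fact (2 * n)) + ln (2 * real n + 1))"
    unfolding wallis_prod_fact using assms by (simp add: ln_div ln_mult ln_realpow add_pos_pos)
  moreover have "ln (2 * real n) = ln 2 + ln (real n)"
    using assms by (simp add: ln_mult)
  ultimately show ?thesis
    unfolding 1 2 stirling_seq_def by (simp add: algebra_simps)
qed

text \<open>Monotonicity and boundedness give some limit L. Comparing the two limits of the
  logarithm of Wallis' product gives 2 L - 2 ln 2 = ln (pi/2), which determines L.\<close>

lemma stirling_seq_LIMSEQ: "stirling_seq \<longlonglongrightarrow> ln (2 * pi) / 2"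
proof -
  obtain L where "(\<lambda>n. stirling_seq (Suc n)) \<longlonglongrightarrow> L"
    using decseq_convergent[OF stirling_seq_decseq, of "3/4"] stirling_seq_lower by blast
  then have L: "stirling_seq \<longlonglongrightarrow> L"
    by (rule LIMSEQ_imp_Suc)
  have L2: "(\<lambda>n. stirling_seq (2 * n)) \<longlonglongrightarrow> L"
    using LIMSEQ_subseq_LIMSEQ[OF L, of "\<lambda>n. 2 * n"] by (simp add: strict_mono_def o_def)
  have "(\<lambda>n. 1 / real n) \<longlonglongrightarrow> 0"
    by (rule lim_1_over_n)
  then have "(\<lambda>n. 4 * stirling_seq n - 2 * stirling_seq (2 * n) - ln 2 - ln (2 + 1 / real n))
      \<longlonglongrightarrow> 4 * L - 2 * L - ln 2 - ln (2 + 0)"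
    by (intro tendsto_intros L L2) auto
  moreover have "\<forall>\<^sub>F n in sequentially. 4 * stirling_seq n - 2 * stirling_seq (2 * n) - ln 2 - ln (2 + 1 / real n)
      = ln (\<Prod>k=1..n. (4*real k^2) / (4*real k^2 - 1))"
    using eventually_gt_at_top[of 0] by eventually_elim (rule ln_wallis_prod[symmetric])
  ultimately have "(\<lambda>n. ln (\<Prod>k=1..n. (4*real k^2) / (4*real k^2 - 1))) \<longlonglongrightarrow> 4 * L - 2 * L - ln 2 - ln (2 + 0)"
    by (rule Lim_transform_eventually)
  moreover have "(\<lambda>n. ln (\<Prod>k=1..n. (4*real k^2) / (4*real k^2 - 1))) \<longlonglongrightarrow> ln (pi / 2)"
    by (intro tendsto_ln wallis) auto
  ultimately have "4 * L - 2 * L - ln 2 - ln (2 + 0) = ln (pi / 2)"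
    by (rule LIMSEQ_unique)
  then have "L = ln (2 * pi) / 2"
    by (simp add: ln_div ln_mult)
  with L show ?thesis by simp
qed

lemma fact_ge_stirling:
  assumes "n > 0"
  shows "fact n \<ge> sqrt (2 * pi * real n) * (real n ^ n * exp (- real n))"
proof -
  have "ln (2 * pi) / 2 \<le> stirling_seq (Suc (n - 1))"
    by (rule decseq_ge[OF stirling_seq_decseq]) (rule LIMSEQ_Suc[OF stirling_seq_LIMSEQ])
  then have "ln (2 * pi) / 2 + (real n + 1/2) * ln (real n) - real n \<le> ln (fact n)"
    using assms by (simp add: stirling_seq_def)
  moreover have "ln (sqrt (2 * pi * real n) * (real n ^ n * exp (- real n)))
     = ln (2 * pi) / 2 + (real n + 1/2) * ln (real n) - real n"
    using assms by (simp add: ln_mult ln_sqrt ln_realpow field_simps)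
  ultimately have "ln (sqrt (2 * pi * real n) * (real n ^ n * exp (- real n))) \<le> ln (fact n)"
    by simp
  then show ?thesis
    using assms by (subst (asm) ln_le_cancel_iff) auto
qed

section \<open>The incomplete Gamma function\<close>

text \<open>Views the identity as a random variable on the density space, so that facts about
  distributed variables yield integrals against the density.\<close>

lemma distributed_erlang_density:
  assumes "0 < l"
  shows "distributed (density lborel (erlang_density k l)) lborel (\<lambda>x. x) (erlang_density k l)"
  unfolding distributed_def by (simp add: distr_id2)

lemma integrable_erlang_density_indicator:
  assumes "0 < l"
  shows "integrable lborel (\<lambda>y. erlang_density k l y * indicator {x..} y)"
proof -
  interpret E: prob_space "density lborel (erlang_density k l)"
    by (rule prob_space_erlang_density) fact
  show ?thesis
    using assms by (subst distributed_integrable[OF distributed_erlang_density])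
      (auto intro!: E.integrable_const_bound[where B=1])
qed

lemma integral_erlang_density_indicator:
  assumes "0 < l" "0 \<le> x"
  shows "(\<integral>y. erlang_density k l y * indicator {x..} y \<partial>lborel) = 1 - erlang_CDF k l x"
proof -
  interpret E: prob_space "density lborel (erlang_density k l)"
    by (rule prob_space_erlang_density) fact
  \<comment> \<open>The Erlang tail formula concerns the event \<open>x < y\<close>; closed and open
    half-lines differ by a null set.\<close>
  have "(\<integral>y. erlang_density k l y * indicator {x..} y \<partial>lborel)
      = (\<integral>y. erlang_density k l y * indicator {x<..} y \<partial>lborel)"
    by (intro integral_cong_AE)
      (use AE_lborel_singleton[of x] in \<open>auto elim!: eventually_mono split: split_indicator\<close>)
  also have "\<dots> = E.expectation (indicator {x<..})"
    using assms by (intro distributed_integral[OF distributed_erlang_density]) auto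
  also have "\<dots> = E.prob {y \<in> space (density lborel (erlang_density k l)). x < y}"
    by (simp add: greaterThan_def)
  also have "\<dots> = 1 - erlang_CDF k l x"
    using assms by (intro E.erlang_distributed_gt distributed_erlang_density)
  finally show ?thesis .
qed

lemma Q_eq_erlang_CDF:
  assumes "0 \<le> x"
  shows "Q (real (Suc k)) x = 1 - erlang_CDF k 1 x"
proof -
  have "upper_Gamma (real (Suc k)) x = (\<integral>y. fact k * (erlang_density k 1 y * indicator {x..} y) \<partial>lborel)"
    unfolding upper_Gamma_def set_lebesgue_integral_def
  proof (intro integral_cong_AE)
    show "AE t in lborel. indicator {x..} t *\<^sub>R (t powr (real (Suc k) - 1) * exp (- t))
        = fact k * (erlang_density k 1 t * indicator {x..} t)"
      \<comment> \<open>The point 0 is discarded because \<open>0 powr 0 = 0\<close> whereas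
        \<open>0 ^ 0 = 1\<close>, so the integrands disagree there when
        \<open>k = 0\<close>.\<close>
      using AE_lborel_singleton[of 0] assms
      by (auto elim!: eventually_mono split: split_indicator simp: erlang_density_def powr_realpow)
  qed auto
  also have "\<dots> = fact k * (1 - erlang_CDF k 1 x)"
    using assms by (simp add: integral_erlang_density_indicator)
  finally show ?thesis
    by (simp add: Q_def Gamma_fact add.commute)
qed

text \<open>The Gamma-Poisson duality: the right-hand side is the probability that a Poisson
  variable of mean \<open>x\<close> is below \<open>c\<close>.\<close>

lemma Q_eq_sum:
  assumes "0 \<le> x" "c > 0"
  shows "Q (real c) x = exp (- x) * (\<Sum>k<c. x ^ k / fact k)"
proof -
  obtain k where c: "c = Suc k" using \<open>c > 0\<close> gr0_implies_Suc by blast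
  show ?thesis
    using assms Q_eq_erlang_CDF[of x k] unfolding c
    by (simp add: erlang_CDF_def sum_distrib_left lessThan_Suc_atMost mult.commute del: of_nat_Suc)
qed

lemma Q_add_1:
  assumes "0 \<le> x" "c > 0"
  shows "Q (real c + 1) x = Q (real c) x + exp (- x) * x ^ c / fact c"
  using Q_eq_sum[of x c] Q_eq_sum[of x "Suc c"] assms by (simp add: algebra_simps)

lemma Q_nonneg: "0 \<le> x \<Longrightarrow> c > 0 \<Longrightarrow> 0 \<le> Q (real c) x"
  by (simp add: Q_eq_sum sum_nonneg)

lemma Q_le_1: "0 \<le> x \<Longrightarrow> c > 0 \<Longrightarrow> Q (real c) x \<le> 1"
  using Q_eq_erlang_CDF[of x "c - 1"] erlang_CDF_nonneg[of 1 "c - 1" x] by simp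

lemma Q_at_0: "c > 0 \<Longrightarrow> Q (real c) 0 = 1"
  by (cases c) (simp_all add: Q_eq_sum sum.lessThan_Suc_shift del: of_nat_Suc sum.lessThan_Suc)

lemma continuous_on_Q: "c > 0 \<Longrightarrow> continuous_on {0..} (Q (real c))"
  by (subst continuous_on_cong[OF refl Q_eq_sum]) (auto intro!: continuous_intros)

lemma Q_tendsto_0:
  assumes "c > 0"
  shows "(Q (real c) \<longlongrightarrow> 0) at_top"
proof -
  have "((\<lambda>x. \<Sum>k<c. x ^ k / exp x / fact k :: real) \<longlongrightarrow> 0) at_top"
    by (intro tendsto_null_sum tendsto_divide_zero tendsto_power_div_exp_0)
  moreover have "\<forall>\<^sub>F x in at_top. (\<Sum>k<c. x ^ k / exp x / fact k) = Q (real c) x"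
    using eventually_ge_at_top[of 0]
    by eventually_elim (simp add: Q_eq_sum assms sum_distrib_left exp_minus field_simps)
  ultimately show ?thesis
    by (simp add: tendsto_cong)
qed

text \<open>The derivatives of consecutive summands telescope, leaving minus the Erlang density. Its
  sign yields strict monotonicity of \<open>Q\<close>.\<close>

lemma exp_partial_sum_has_derivative:
  "((\<lambda>x. exp (- x) * (\<Sum>k\<le>n. x ^ k / fact k)) has_real_derivative - (exp (- x) * x ^ n / fact n)) (at x)"
proof (induction n)
  case 0
  show ?case by (auto intro!: derivative_eq_intros)
next
  case (Suc n)
  have "((\<lambda>x. exp (- x) * (x ^ Suc n / fact (Suc n))) has_real_derivative
      exp (- x) * x ^ n / fact n - exp (- x) * x ^ Suc n / fact (Suc n)) (at x)"
    by (rule derivative_eq_intros refl | simp)+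
  from DERIV_add[OF Suc this] show ?case
    by (simp add: distrib_left)
qed

lemma Q_strict_antimono:
  assumes "0 \<le> x" "x < y" "c > 0"
  shows "Q (real c) y < Q (real c) x"
proof -
  obtain k where c: "c = Suc k" using \<open>c > 0\<close> gr0_implies_Suc by blast
  have "(\<lambda>x. exp (- x) * (\<Sum>i\<le>k. x ^ i / fact i)) y < (\<lambda>x. exp (- x) * (\<Sum>i\<le>k. x ^ i / fact i)) x"
  \<comment> \<open>Only interior points are tested: the derivative vanishes at 0 when
    \<open>k > 0\<close>, and \<open>x = 0\<close> is allowed.\<close>
  proof (rule DERIV_neg_imp_decreasing_open[OF \<open>x < y\<close>])
    fix t assume "x < t" "t < y"
    then show "\<exists>d. ((\<lambda>x. exp (- x) * (\<Sum>i\<le>k. x ^ i / fact i)) has_real_derivative d) (at t) \<and> d < 0"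
      using assms by (intro exI[of _ "- (exp (- t) * t ^ k / fact k)"] conjI exp_partial_sum_has_derivative) simp
  qed (auto intro!: continuous_intros)
  then show ?thesis
    using assms by (simp add: Q_eq_sum c lessThan_Suc_atMost del: of_nat_Suc)
qed

lemma inj_on_Q: "c > 0 \<Longrightarrow> inj_on (Q (real c)) {0..}"
  by (rule linorder_inj_onI') (auto dest!: Q_strict_antimono)

text \<open>\<open>Q\<close> equals 1 at 0 and tends to 0, so the intermediate value theorem puts
  \<open>p\<close> in its range. With injectivity, \<open>the_inv_into\<close> is then a genuine
  inverse at \<open>p\<close>.\<close>

lemma Q_Q_inv:
  assumes "0 < p" "p \<le> 1" "c > 0"
  shows "Q (real c) (Q_inv (real c) p) = p" and "Q_inv (real c) p \<ge> 0"
proof -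
  have "\<forall>\<^sub>F x in at_top. Q (real c) x < p"
    using order_tendstoD(2)[OF Q_tendsto_0] assms by blast
  then obtain b where b: "b \<ge> 0" "Q (real c) b < p"
    using eventually_happens[OF eventually_conj[OF _ eventually_ge_at_top[of 0]]] by auto
  have "\<exists>x\<ge>0. x \<le> b \<and> Q (real c) x = p"
    using b assms by (intro IVT2') (auto simp: Q_at_0 intro: continuous_on_subset[OF continuous_on_Q])
  then have p: "p \<in> Q (real c) ` {0..}"
    by auto
  show "Q (real c) (Q_inv (real c) p) = p"
    unfolding Q_inv_def using p inj_on_Q[OF assms(3)] by (rule f_the_inv_into_f[rotated])
  show "Q_inv (real c) p \<ge> 0"
    unfolding Q_inv_def using the_inv_into_into[OF inj_on_Q[OF assms(3)] p order_refl] by simp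
qed

text \<open>The inequality 1 + u \<le> exp u at u = x/c - 1, raised to the power
  \<open>c\<close>.\<close>

lemma power_mult_exp_minus_le:
  assumes "0 \<le> x" "c > 0"
  shows "x ^ c * exp (- x) \<le> real c ^ c * exp (- real c)"
proof -
  have "x / real c \<le> exp (x / real c - 1)"
    using exp_ge_add_one_self[of "x / real c - 1"] by simp
  then have "(x / real c) ^ c \<le> exp (x / real c - 1) ^ c"
    using assms by (intro power_mono) auto
  also have "\<dots> = exp (x - real c)"
    using assms by (simp add: exp_of_nat_mult[symmetric] algebra_simps)
  finally show ?thesis
    using assms by (simp add: field_simps exp_diff exp_minus)
qed

lemma Q_Suc_Q_inv_le:
  assumes "n > 0" "c > 0"
  shows "real n * Q (real c + 1) (Q_inv (real c) (1 / real n)) \<le> u_tilde n c"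
proof -
  define x where "x = Q_inv (real c) (1 / real n)"
  have x: "Q (real c) x = 1 / real n" "x \<ge> 0"
    unfolding x_def using assms by (intro Q_Q_inv; simp)+
  have "exp (- x) * x ^ c / fact c \<le> real c ^ c * exp (- real c) / fact c"
    using power_mult_exp_minus_le[OF x(2) assms(2)] by (intro divide_right_mono) (auto simp: mult.commute)
  also have "\<dots> \<le> 1 / sqrt (2 * pi * real c)"
    using fact_ge_stirling[OF assms(2)] assms by (simp add: divide_simps mult.commute)
  finally have "real n * Q (real c + 1) x \<le> real n * (1 / real n + 1 / sqrt (2 * pi * real c))"
    using x assms by (intro mult_left_mono) (auto simp: Q_add_1)
  then show ?thesis
    using assms by (simp add: x_def u_tilde_def distrib_left)
qed

section \<open>Expected excess of a Gamma variable over a threshold\<close>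

lemma erlang_density_mult_self:
  "erlang_density k 1 y * y = real (Suc k) * erlang_density (Suc k) 1 y"
  by (simp add: erlang_density_def field_simps del: of_nat_Suc)

text \<open>The positive part is y - x on \<open>{x..}\<close>. Multiplying the density by y raises
  the shape by one, whence the argument \<open>c + 1\<close> of \<open>Q\<close>. The index
  \<open>c - 1\<close> appears because \<open>erlang_density k\<close> has shape
  \<open>k + 1\<close>.\<close>

lemma
  assumes "0 \<le> x" "c > 0"
  shows integrable_erlang_density_excess:
      "integrable lborel (\<lambda>y. erlang_density (c - 1) 1 y * max 0 (y - x))" (is ?int)
    and integral_erlang_density_excess:
      "(\<integral>y. erlang_density (c - 1) 1 y * max 0 (y - x) \<partial>lborel)
         = real c * Q (real c + 1) x - x * Q (real c) x" (is ?eq)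
proof -
  obtain k where c: "c = Suc k" using \<open>c > 0\<close> gr0_implies_Suc by blast
  have *: "(\<lambda>y. erlang_density (c - 1) 1 y * max 0 (y - x))
      = (\<lambda>y. real c * (erlang_density (Suc k) 1 y * indicator {x..} y)
              - x * (erlang_density k 1 y * indicator {x..} y))"
    using erlang_density_mult_self[of k]
    by (auto simp: c fun_eq_iff max_def algebra_simps split: split_indicator)
  show ?int ?eq
    using assms unfolding *
    by (simp_all add: integrable_erlang_density_indicator integral_erlang_density_indicator
        c Q_eq_erlang_CDF[symmetric] add.commute)
qed

section \<open>Coupling with exponential variables\<close>

text \<open>Connects independent variables on an arbitrary space with the product pmf in
  \<open>NegBin\<close>: both joint laws on \<open>I\<close> are the product of the same marginals,
  and the sum is a function of the joint vector.\<close>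

lemma (in prob_space) distr_sum_indep_eq_Pi_pmf:
  fixes X :: "'i \<Rightarrow> 'a \<Rightarrow> nat"
  assumes I: "finite I" "I \<noteq> {}"
    and indep: "indep_vars (\<lambda>_. count_space UNIV) X I"
    and D: "\<And>i. i \<in> I \<Longrightarrow> distr M (count_space UNIV) (X i) = measure_pmf (D i)"
  shows "distr M (count_space UNIV) (\<lambda>\<omega>. \<Sum>i\<in>I. X i \<omega>)
    = measure_pmf (map_pmf (\<lambda>g. \<Sum>i\<in>I. g i) (Pi_pmf I dflt D))"
proof -
  let ?C = "\<lambda>_::'i. count_space (UNIV :: nat set)"
  have [measurable]: "X i \<in> measurable M (count_space UNIV)" if "i \<in> I" for i
    using indep that by (auto simp: indep_vars_def)
  have [measurable]: "(\<lambda>g. \<Sum>i\<in>I. g i) \<in> measurable (Pi\<^sub>M I ?C) (count_space UNIV)"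
    by measurable
  have "distr M (Pi\<^sub>M I ?C) (\<lambda>x. \<lambda>i\<in>I. X i x) = Pi\<^sub>M I (\<lambda>i. distr M (count_space UNIV) (X i))"
    using indep I by (subst indep_vars_iff_distr_eq_PiM'[symmetric]) auto
  also have "\<dots> = Pi\<^sub>M I (\<lambda>i. distr (measure_pmf (Pi_pmf I dflt D)) (count_space UNIV) (\<lambda>f. f i))"
    using I D by (intro PiM_cong refl) (simp add: Pi_pmf_component map_pmf_rep_eq[symmetric])
  \<comment> \<open>Samples of \<open>Pi_pmf\<close> take the value \<open>dflt\<close> outside
    \<open>I\<close>, while \<open>PiM\<close> lives on extensional functions;
    \<open>restrict\<close> translates between them and leaves the sum over \<open>I\<close>
    unchanged.\<close>
  also have "\<dots> = distr (measure_pmf (Pi_pmf I dflt D)) (Pi\<^sub>M I ?C) (\<lambda>x. restrict x I)"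
    using prob_space.indep_vars_iff_distr_eq_PiM'
      [where M = "measure_pmf (Pi_pmf I dflt D)" and I = I and M' = ?C and X = "\<lambda>i f. f i"]
      indep_vars_Pi_pmf[of I dflt D] I by (auto simp: measure_pmf.prob_space_axioms)
  finally have *: "distr M (Pi\<^sub>M I ?C) (\<lambda>x. \<lambda>i\<in>I. X i x)
      = distr (measure_pmf (Pi_pmf I dflt D)) (Pi\<^sub>M I ?C) (\<lambda>x. restrict x I)" .
  have "distr M (count_space UNIV) (\<lambda>\<omega>. \<Sum>i\<in>I. X i \<omega>)
      = distr (distr M (Pi\<^sub>M I ?C) (\<lambda>x. \<lambda>i\<in>I. X i x)) (count_space UNIV) (\<lambda>g. \<Sum>i\<in>I. g i)"
    by (subst distr_distr) (auto simp: o_def intro!: distr_cong)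
  also have "\<dots> = distr (measure_pmf (Pi_pmf I dflt D)) (count_space UNIV) (\<lambda>g. \<Sum>i\<in>I. g i)"
    unfolding * by (subst distr_distr) (auto simp: o_def space_PiM intro!: distr_cong)
  finally show ?thesis
    by (simp add: map_pmf_rep_eq)
qed

lemma phi_pos: "0 < q \<Longrightarrow> q < 1 \<Longrightarrow> phi q > 0"
  by (simp add: phi_def)

text \<open>An exponential variable exceeds \<open>k * phi q\<close> with probability
  \<open>(1 - q) ^ k\<close>, the geometric tail. The integer part counts failures, and
  \<open>Suc\<close> turns this into trials.\<close>

lemma geometric_eq_floor_exponential:
  assumes "0 < q" "q < 1"
  shows "distr (density lborel (exponential_density 1)) (count_space UNIV) (\<lambda>x. Suc (nat \<lfloor>x / phi q\<rfloor>))
       = measure_pmf (map_pmf Suc (geometric_pmf q))"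
proof -
  let ?E = "density lborel (exponential_density 1)"
  interpret E: prob_space ?E
    by (rule prob_space_exponential_density) simp
  have pos: "phi q > 0" using assms by (rule phi_pos)
  have tail: "E.prob {real k * phi q..} = (1 - q) ^ k" for k
  proof -
    have "E.prob {real k * phi q..} = (\<integral>y. exponential_density 1 y * indicator {real k * phi q..} y \<partial>lborel)"
      by (subst distributed_integral[OF distributed_erlang_density]) auto
    also have "\<dots> = exp (- (real k * phi q))"
      using pos by (simp add: integral_erlang_density_indicator erlang_CDF_0)
    also have "\<dots> = (1 - q) ^ k"
      using assms by (simp add: phi_def exp_of_nat_mult)
    finally show ?thesis .
  qed
  have "distr ?E (count_space UNIV) (\<lambda>x. nat \<lfloor>x / phi q\<rfloor>) = measure_pmf (geometric_pmf q)"
  proof (rule measure_eqI_countable)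
    fix k
    have "(\<lambda>x. nat \<lfloor>x / phi q\<rfloor>) \<in> measurable borel (count_space UNIV)"
      by measurable
    from measurable_sets[OF this, of "{k}"]
    have [simp]: "(\<lambda>x. nat \<lfloor>x / phi q\<rfloor>) -` {k} \<in> sets borel"
      by simp
    \<comment> \<open>Negative x have density zero but are all sent to 0 by \<open>nat\<close>, so
      the preimage of \<open>k\<close> is the half-open interval only almost everywhere.\<close>
    have "AE x in ?E. (x \<in> (\<lambda>x. nat \<lfloor>x / phi q\<rfloor>) -` {k}) = (x \<in> {real k * phi q..} - {real (Suc k) * phi q..})"
    proof (subst AE_density, simp, rule AE_I2, rule impI)
      fix x :: real assume "0 < ennreal (exponential_density 1 x)"
      then have "x \<ge> 0" by (auto simp: erlang_density_def split: if_splits)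
      then have "nat \<lfloor>x / phi q\<rfloor> = k \<longleftrightarrow> real k \<le> x / phi q \<and> x / phi q < real k + 1"
        using pos by (simp add: nat_eq_iff floor_eq_iff)
      then show "(x \<in> (\<lambda>x. nat \<lfloor>x / phi q\<rfloor>) -` {k}) = (x \<in> {real k * phi q..} - {real (Suc k) * phi q..})"
        using pos by (auto simp: field_simps)
    qed
    then have "E.prob ((\<lambda>x. nat \<lfloor>x / phi q\<rfloor>) -` {k})
        = E.prob ({real k * phi q..} - {real (Suc k) * phi q..})"
      by (intro E.finite_measure_eq_AE) auto
    also have "\<dots> = (1 - q) ^ k - (1 - q) ^ Suc k"
      using pos by (subst E.finite_measure_Diff) (auto simp: tail simp del: of_nat_Suc)
    finally show "emeasure (distr ?E (count_space UNIV) (\<lambda>x. nat \<lfloor>x / phi q\<rfloor>)) {k}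
        = emeasure (measure_pmf (geometric_pmf q)) {k}"
      using assms by (simp add: emeasure_distr E.emeasure_eq_measure emeasure_pmf_single algebra_simps)
  qed auto
  then show ?thesis
    by (simp add: map_pmf_rep_eq distr_distr o_def flip: \<open>_ = measure_pmf (geometric_pmf q)\<close>)
qed

text \<open>On the product of \<open>c\<close> exponential laws, \<open>G\<close> sums the
  coordinates and \<open>Z\<close> their rounded-up versions. Each rounding adds at most 1, hence
  the total error \<open>c\<close>. The upper estimate is almost sure only, since it fails for
  negative coordinates.\<close>

lemma NegBin_Gamma_coupling:
  assumes "0 < q" "q < 1" "c > 0"
  obtains N :: "(nat \<Rightarrow> real) measure" and G Z where
    "prob_space N"
    "distributed N lborel G (erlang_density (c - 1) 1)"
    "Z \<in> measurable N (count_space UNIV)"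
    "distr N (count_space UNIV) Z = measure_pmf (NegBin c q)"
    "\<And>\<omega>. G \<omega> \<le> phi q * real (Z \<omega>)"
    "AE \<omega> in N. phi q * real (Z \<omega>) \<le> G \<omega> + phi q * real c"
proof -
  let ?E = "density lborel (exponential_density 1)"
  let ?f = "\<lambda>x. Suc (nat \<lfloor>x / phi q\<rfloor>)"
  define N where "N = Pi\<^sub>M {..<c} (\<lambda>_. ?E)"
  define G where "G = (\<lambda>\<omega>::nat \<Rightarrow> real. \<Sum>i<c. \<omega> i)"
  define Z where "Z = (\<lambda>\<omega>::nat \<Rightarrow> real. \<Sum>i<c. ?f (\<omega> i))"
  have pos: "phi q > 0" using assms(1,2) by (rule phi_pos)
  have E: "prob_space ?E"
    by (rule prob_space_exponential_density) simp
  interpret N: prob_space N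
    unfolding N_def by (intro prob_space_PiM E)
  have ne: "{..<c} \<noteq> {}" using assms(3) by auto
  have sets_N[measurable_cong]: "sets N = sets (Pi\<^sub>M {..<c} (\<lambda>_. borel))"
    unfolding N_def by (intro sets_PiM_cong) auto
  have space_N: "space N = ({..<c} \<rightarrow>\<^sub>E UNIV)"
    by (simp add: N_def space_PiM)
  have comp: "distr N borel (\<lambda>\<omega>. \<omega> i) = ?E" if "i < c" for i
  proof -
    have "distr N borel (\<lambda>\<omega>. \<omega> i) = distr N ?E (\<lambda>\<omega>. \<omega> i)"
      by (intro distr_cong) auto
    then show ?thesis
      using distr_PiM_component[of "{..<c}" "\<lambda>_. ?E" i] E that by (simp add: N_def)
  qed
  \<comment> \<open>Independence of the coordinates: points of \<open>N\<close> are extensional, so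
    restriction is the identity and the joint law is \<open>N\<close> itself, the product of its
    marginals.\<close>
  have "distr N (Pi\<^sub>M {..<c} (\<lambda>_. borel)) (\<lambda>x. \<lambda>i\<in>{..<c}. x i) = distr N N (\<lambda>x. x)"
    using sets_N by (intro distr_cong) (auto simp: space_N PiE_restrict)
  also have "\<dots> = Pi\<^sub>M {..<c} (\<lambda>i. distr N borel (\<lambda>\<omega>. \<omega> i))"
    by (subst distr_id) (simp add: N_def, intro PiM_cong, auto simp: comp simp flip: N_def)
  finally have indep: "N.indep_vars (\<lambda>_. borel) (\<lambda>i \<omega>. \<omega> i) {..<c}"
    using ne by (subst N.indep_vars_iff_distr_eq_PiM') auto
  have 1: "distributed N lborel G (erlang_density (c - 1) 1)"
  proof -
    have "distributed N lborel (\<lambda>\<omega>. \<omega> i) (exponential_density 1)" if "i < c" for i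
      using comp[OF that] that unfolding distributed_def by (auto cong: distr_cong)
    then show ?thesis
      unfolding G_def using N.exponential_distributed_sum[OF _ ne zero_less_one _ indep] by simp
  qed
  have Zm: "Z \<in> measurable N (count_space UNIV)"
    unfolding Z_def by measurable
  have indepZ: "N.indep_vars (\<lambda>_. count_space UNIV) (\<lambda>i \<omega>. ?f (\<omega> i)) {..<c}"
    by (rule N.indep_vars_compose2[OF indep]) measurable
  have 2: "distr N (count_space UNIV) Z = measure_pmf (NegBin c q)"
    unfolding Z_def NegBin_def
  proof (rule N.distr_sum_indep_eq_Pi_pmf[OF _ ne indepZ])
    fix i assume i: "i \<in> {..<c}"
    have "distr N (count_space UNIV) (\<lambda>\<omega>. ?f (\<omega> i)) = distr (distr N borel (\<lambda>\<omega>. \<omega> i)) (count_space UNIV) ?f"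
      using i by (subst distr_distr) (auto simp: o_def)
    then show "distr N (count_space UNIV) (\<lambda>\<omega>. ?f (\<omega> i)) = measure_pmf (map_pmf Suc (geometric_pmf q))"
      using i comp geometric_eq_floor_exponential[OF assms(1,2)] by simp
  qed auto
  have "x \<le> phi q * real (?f x)" for x
  proof -
    have "x / phi q \<le> real (?f x)" by linarith
    then show ?thesis using pos by (simp add: field_simps)
  qed
  then have 3: "G \<omega> \<le> phi q * real (Z \<omega>)" for \<omega>
    unfolding G_def Z_def of_nat_sum sum_distrib_left by (intro sum_mono)
  have "AE x in ?E. 0 \<le> x"
    by (subst AE_density) (auto simp: erlang_density_def)
  then have "AE \<omega> in N. \<forall>i\<in>{..<c}. 0 \<le> \<omega> i"
    unfolding N_def by (intro AE_finite_allI AE_PiM_component E) auto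
  then have 4: "AE \<omega> in N. phi q * real (Z \<omega>) \<le> G \<omega> + phi q * real c"
  proof eventually_elim
    case (elim \<omega>)
    have "phi q * real (?f (\<omega> i)) \<le> \<omega> i + phi q" if "i < c" for i
    proof -
      have "0 \<le> \<omega> i / phi q" using elim that pos by simp
      then have "real (?f (\<omega> i)) \<le> \<omega> i / phi q + 1" by linarith
      then have "phi q * real (?f (\<omega> i)) \<le> phi q * (\<omega> i / phi q + 1)"
        using pos by (intro mult_left_mono) auto
      then show ?thesis using pos by (simp add: distrib_left)
    qed
    then have "phi q * real (Z \<omega>) \<le> (\<Sum>i<c. \<omega> i + phi q)"
      unfolding Z_def of_nat_sum sum_distrib_left by (intro sum_mono) auto
    then show ?case
      by (simp add: G_def sum.distrib mult.commute)
  qed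
  from that[OF N.prob_space_axioms 1 Zm 2 3 4] show ?thesis .
qed

text \<open>Everything needed about \<open>NegBin\<close> is read off the coupling: mean and tail
  from below by \<open>G \<le> phi q * Z\<close>, integrability and excess from above by the reverse
  estimate.\<close>

lemma
  assumes "0 < q" "q < 1" "c > 0"
  shows integrable_NegBin: "integrable (NegBin c q) real"
    and expectation_NegBin_ge: "measure_pmf.expectation (NegBin c q) real \<ge> real c / phi q"
    and NegBin_tail_ge:
      "0 \<le> t \<Longrightarrow> Q (real c) t \<le> measure_pmf.prob (NegBin c q) {y. t / phi q \<le> real y}"
    and NegBin_excess_le:
      "0 \<le> x \<Longrightarrow> measure_pmf.expectation (NegBin c q) (\<lambda>y. max 0 (real y - (real c + x / phi q)))
         \<le> (real c * Q (real c + 1) x - x * Q (real c) x) / phi q"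
proof -
  obtain N :: "(nat \<Rightarrow> real) measure" and G Z where
    N: "prob_space N"
    and G: "distributed N lborel G (erlang_density (c - 1) 1)"
    and Z[measurable]: "Z \<in> measurable N (count_space UNIV)"
    and law: "distr N (count_space UNIV) Z = measure_pmf (NegBin c q)"
    and GZ: "\<And>\<omega>. G \<omega> \<le> phi q * real (Z \<omega>)"
    and ZG: "AE \<omega> in N. phi q * real (Z \<omega>) \<le> G \<omega> + phi q * real c"
    by (rule NegBin_Gamma_coupling[OF assms]) (rule that, assumption+)
  interpret N: prob_space N by fact
  have pos: "phi q > 0" using assms(1,2) by (rule phi_pos)
  have [measurable]: "G \<in> borel_measurable N"
    using distributed_measurable[OF G] by simp
  have int_G: "integrable N G"
    using N.erlang_ith_moment_integrable[OF _ G, of 1] by simp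
  have exp_G: "N.expectation G = real c"
    using N.erlang_ith_moment[OF _ G, of 1] assms(3) by (cases c) simp_all
  have int_Z: "integrable N (\<lambda>\<omega>. real (Z \<omega>))"
  proof (rule Bochner_Integration.integrable_bound)
    show "integrable N (\<lambda>\<omega>. G \<omega> / phi q + real c)"
      using int_G by simp
    show "AE \<omega> in N. norm (real (Z \<omega>)) \<le> norm (G \<omega> / phi q + real c)"
      using ZG
    proof eventually_elim
      case (elim \<omega>)
      then have "real (Z \<omega>) \<le> G \<omega> / phi q + real c"
        using pos by (simp add: field_simps)
      then show ?case by simp
    qed
  qed simp
  show "integrable (NegBin c q) real"
    unfolding law[symmetric] by (subst integrable_distr_eq) (use int_Z in auto)
  have "real c / phi q = N.expectation (\<lambda>\<omega>. G \<omega> / phi q)"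
    by (simp add: exp_G)
  also have "\<dots> \<le> N.expectation (\<lambda>\<omega>. real (Z \<omega>))"
    using int_G int_Z GZ pos by (intro integral_mono) (auto simp: field_simps)
  also have "\<dots> = measure_pmf.expectation (NegBin c q) real"
    unfolding law[symmetric] by (subst integral_distr) auto
  finally show "measure_pmf.expectation (NegBin c q) real \<ge> real c / phi q" .
  show "Q (real c) t \<le> measure_pmf.prob (NegBin c q) {y. t / phi q \<le> real y}" if "0 \<le> t"
  proof -
    have "Q (real c) t = N.prob {\<omega> \<in> space N. t < G \<omega>}"
      using N.erlang_distributed_gt[OF G _ that] Q_eq_erlang_CDF[OF that, of "c - 1"] assms(3) by simp
    also have "\<dots> \<le> N.prob (Z -` {y. t / phi q \<le> real y} \<inter> space N)"
    proof (rule N.finite_measure_mono)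
      show "{\<omega> \<in> space N. t < G \<omega>} \<subseteq> Z -` {y. t / phi q \<le> real y} \<inter> space N"
      proof
        fix \<omega> assume "\<omega> \<in> {\<omega> \<in> space N. t < G \<omega>}"
        then show "\<omega> \<in> Z -` {y. t / phi q \<le> real y} \<inter> space N"
          using GZ[of \<omega>] pos by (simp add: field_simps)
      qed
    qed measurable
    also have "\<dots> = measure_pmf.prob (NegBin c q) {y. t / phi q \<le> real y}"
      unfolding law[symmetric] by (subst measure_distr) auto
    finally show ?thesis .
  qed
  show "measure_pmf.expectation (NegBin c q) (\<lambda>y. max 0 (real y - (real c + x / phi q)))
         \<le> (real c * Q (real c + 1) x - x * Q (real c) x) / phi q" if "0 \<le> x"
  proof -
    have int: "integrable N (\<lambda>\<omega>. max 0 (G \<omega> - x))"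
      using distributed_integrable[OF G, of "\<lambda>y. max 0 (y - x)"]
        integrable_erlang_density_excess[OF that assms(3)] by simp
    have "measure_pmf.expectation (NegBin c q) (\<lambda>y. max 0 (real y - (real c + x / phi q)))
        = N.expectation (\<lambda>\<omega>. max 0 (real (Z \<omega>) - (real c + x / phi q)))"
      unfolding law[symmetric] by (subst integral_distr) auto
    also have "\<dots> \<le> N.expectation (\<lambda>\<omega>. max 0 (G \<omega> - x) / phi q)"
    proof (rule integral_mono_AE)
      show "integrable N (\<lambda>\<omega>. max 0 (real (Z \<omega>) - (real c + x / phi q)))"
        using int_Z by simp
      show "AE \<omega> in N. max 0 (real (Z \<omega>) - (real c + x / phi q)) \<le> max 0 (G \<omega> - x) / phi q"
        using ZG
      proof eventually_elim
        case (elim \<omega>)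
        \<comment> \<open>The summand \<open>c\<close> in the threshold absorbs the rounding error,
          which leaves exactly the excess of \<open>G\<close> over \<open>x\<close>.\<close>
        then have "real (Z \<omega>) \<le> (G \<omega> + phi q * real c) / phi q"
          using pos by (simp add: pos_le_divide_eq mult.commute)
        then have "real (Z \<omega>) - (real c + x / phi q) \<le> (G \<omega> - x) / phi q"
          using pos by (simp add: add_divide_distrib diff_divide_distrib)
        also have "\<dots> \<le> max 0 (G \<omega> - x) / phi q"
          using pos by (intro divide_right_mono) auto
        finally show ?case using pos by simp
      qed
    qed (use int in simp)
    also have "\<dots> = N.expectation (\<lambda>\<omega>. max 0 (G \<omega> - x)) / phi q"
      by simp
    also have "N.expectation (\<lambda>\<omega>. max 0 (G \<omega> - x)) = real c * Q (real c + 1) x - x * Q (real c) x"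
      using distributed_integral[OF G, of "\<lambda>y. max 0 (y - x)"]
        integral_erlang_density_excess[OF that assms(3)] by simp
    finally show ?thesis .
  qed
qed

section \<open>The expected maximum\<close>

lemma real_Max_image:
  assumes "finite A" "A \<noteq> {}"
  shows "real (MAX j\<in>A. f j) = (MAX j\<in>A. real (f j))"
  using assms mono_Max_commute[of real "f ` A"] by (simp add: image_image mono_def)

lemma integrable_real_Max:
  fixes Y :: "'i \<Rightarrow> 'a \<Rightarrow> nat"
  assumes A: "finite A" "A \<noteq> {}"
    and meas: "\<And>j. j \<in> A \<Longrightarrow> Y j \<in> measurable M (count_space UNIV)"
    and int: "\<And>j. j \<in> A \<Longrightarrow> integrable M (\<lambda>\<omega>. real (Y j \<omega>))"
  shows "integrable M (\<lambda>\<omega>. real (MAX j\<in>A. Y j \<omega>))"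
proof (rule Bochner_Integration.integrable_bound)
  show "integrable M (\<lambda>\<omega>. \<Sum>j\<in>A. real (Y j \<omega>))"
    using int by simp
  show "(\<lambda>\<omega>. real (MAX j\<in>A. Y j \<omega>)) \<in> borel_measurable M"
    unfolding real_Max_image[OF A] using A meas by (intro borel_measurable_Max) measurable
  show "AE \<omega> in M. norm (real (MAX j\<in>A. Y j \<omega>)) \<le> norm (\<Sum>j\<in>A. real (Y j \<omega>))"
  proof (rule AE_I2)
    fix \<omega>
    have "real (MAX j\<in>A. Y j \<omega>) \<le> (\<Sum>j\<in>A. real (Y j \<omega>))"
      unfolding real_Max_image[OF A] using A by (intro Max.boundedI) (auto intro!: member_le_sum)
    then show "norm (real (MAX j\<in>A. Y j \<omega>)) \<le> norm (\<Sum>j\<in>A. real (Y j \<omega>))"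
      by simp
  qed
qed

lemma (in prob_space) expectation_Max_le:
  fixes Y :: "'i \<Rightarrow> 'a \<Rightarrow> nat"
  assumes A: "finite A" "A \<noteq> {}"
    and meas: "\<And>j. j \<in> A \<Longrightarrow> Y j \<in> measurable M (count_space UNIV)"
    and int: "\<And>j. j \<in> A \<Longrightarrow> integrable M (\<lambda>\<omega>. real (Y j \<omega>))"
    and excess: "\<And>j. j \<in> A \<Longrightarrow> expectation (\<lambda>\<omega>. max 0 (real (Y j \<omega>) - s)) \<le> b"
  shows "expectation (\<lambda>\<omega>. real (MAX j\<in>A. Y j \<omega>)) \<le> s + real (card A) * b"
proof -
  have int1: "integrable M (\<lambda>\<omega>. max 0 (real (Y j \<omega>) - s))" if "j \<in> A" for j
    using int[OF that] by simp
  then have int2: "integrable M (\<lambda>\<omega>. \<Sum>j\<in>A. max 0 (real (Y j \<omega>) - s))"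
    by simp
  have "expectation (\<lambda>\<omega>. real (MAX j\<in>A. Y j \<omega>))
      \<le> expectation (\<lambda>\<omega>. s + (\<Sum>j\<in>A. max 0 (real (Y j \<omega>) - s)))"
  proof (rule integral_mono)
    show "integrable M (\<lambda>\<omega>. real (MAX j\<in>A. Y j \<omega>))"
      using A meas int by (rule integrable_real_Max)
    show "integrable M (\<lambda>\<omega>. s + (\<Sum>j\<in>A. max 0 (real (Y j \<omega>) - s)))"
      using int2 by simp
    fix \<omega>
    have "real (Y j \<omega>) \<le> s + (\<Sum>j\<in>A. max 0 (real (Y j \<omega>) - s))" if "j \<in> A" for j
    proof -
      have "max 0 (real (Y j \<omega>) - s) \<le> (\<Sum>j\<in>A. max 0 (real (Y j \<omega>) - s))"
        using A that by (intro member_le_sum) auto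
      then show ?thesis by linarith
    qed
    then show "real (MAX j\<in>A. Y j \<omega>) \<le> s + (\<Sum>j\<in>A. max 0 (real (Y j \<omega>) - s))"
      unfolding real_Max_image[OF A] using A by (intro Max.boundedI) auto
  qed
  also have "\<dots> = s + (\<Sum>j\<in>A. expectation (\<lambda>\<omega>. max 0 (real (Y j \<omega>) - s)))"
    using int1 int2 by (simp add: prob_space)
  also have "\<dots> \<le> s + (\<Sum>j\<in>A. b)"
    using excess by (intro add_left_mono sum_mono) auto
  finally show ?thesis by simp
qed

text \<open>The event that the first \<open>n - 1\<close> variables stay below \<open>s\<close> has
  probability \<open>(1 - p) ^ (n - 1)\<close> and is independent of \<open>Y n\<close>. On it the
  maximum is at least \<open>Y n\<close>, off it at least \<open>s\<close>.\<close>

lemma (in prob_space) expectation_Max_ge: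
  fixes Y :: "nat \<Rightarrow> 'a \<Rightarrow> nat"
  assumes n: "n > 0"
    and indep: "indep_vars (\<lambda>_. count_space UNIV) Y {1..n}"
    and int: "\<And>j. j \<in> {1..n} \<Longrightarrow> integrable M (\<lambda>\<omega>. real (Y j \<omega>))"
    and tail: "\<And>j. j \<in> {1..n} \<Longrightarrow> prob {\<omega> \<in> space M. s \<le> real (Y j \<omega>)} = p"
  shows "expectation (\<lambda>\<omega>. real (MAX j\<in>{1..n}. Y j \<omega>))
      \<ge> (1 - p) ^ (n - 1) * expectation (\<lambda>\<omega>. real (Y n \<omega>)) + (1 - (1 - p) ^ (n - 1)) * s"
proof -
  define I where "I = (\<lambda>j \<omega>. of_bool (real (Y j \<omega>) < s) :: real)"
  have meas[measurable]: "Y j \<in> measurable M (count_space UNIV)" if "j \<in> {1..n}" for j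
    using indep that by (auto simp: indep_vars_def)
  have I_meas[measurable]: "I j \<in> borel_measurable M" if "j \<in> {1..n}" for j
    using meas[OF that] unfolding I_def by measurable
  have int_I: "integrable M (I j)" if "j \<in> {1..n}" for j
    using I_meas[OF that] by (intro integrable_const_bound[where B=1]) (auto simp: I_def)
  have exp_I: "expectation (I j) = 1 - p" if "j \<in> {1..n}" for j
  proof -
    have [measurable]: "Y j \<in> measurable M (count_space UNIV)" using meas that .
    have [simp]: "{\<omega> \<in> space M. s \<le> real (Y j \<omega>)} \<in> events"
      by measurable
    have [simp]: "integrable M (indicator {\<omega> \<in> space M. s \<le> real (Y j \<omega>)} :: 'a \<Rightarrow> real)"
      by (simp add: emeasure_eq_measure)
    have "expectation (I j) = expectation (\<lambda>\<omega>. 1 - indicator {\<omega> \<in> space M. s \<le> real (Y j \<omega>)} \<omega>)"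
      by (intro Bochner_Integration.integral_cong) (auto simp: I_def split: split_indicator)
    also have "\<dots> = 1 - prob {\<omega> \<in> space M. s \<le> real (Y j \<omega>)}"
      by (subst Bochner_Integration.integral_diff) (auto simp: prob_space)
    finally show ?thesis
      using tail[OF that] by simp
  qed
  have split: "{1..n} = insert n {1..<n}" using n by auto
  let ?P = "\<lambda>\<omega>. \<Prod>j\<in>{1..<n}. I j \<omega>"
  \<comment> \<open>Stated for general \<open>f\<close> to be used twice: \<open>f = 1\<close> gives
    the probability of the event, \<open>f = real\<close> the mean of \<open>Y n\<close> on
    it.\<close>
  have *: "integrable M (\<lambda>\<omega>. f (Y n \<omega>) * ?P \<omega>) \<and>
      expectation (\<lambda>\<omega>. f (Y n \<omega>) * ?P \<omega>) = expectation (\<lambda>\<omega>. f (Y n \<omega>)) * (1 - p) ^ (n - 1)"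
    if f: "integrable M (\<lambda>\<omega>. f (Y n \<omega>))" for f :: "nat \<Rightarrow> real"
  proof -
    \<comment> \<open>Slot \<open>n\<close> carries \<open>f (Y n)\<close> and the others the
      indicators, so one independent family has the desired product and its expectation
      factorises.\<close>
    define X where "X = (\<lambda>j \<omega>. if j = n then f (Y j \<omega>) else I j \<omega>)"
    have X: "(\<Prod>j\<in>{1..n}. X j \<omega>) = f (Y n \<omega>) * ?P \<omega>" for \<omega>
      unfolding split by (simp add: X_def)
    have "indep_vars (\<lambda>_. borel) (\<lambda>j \<omega>. (if j = n then f else (\<lambda>y. of_bool (real y < s))) (Y j \<omega>)) {1..n}"
      by (rule indep_vars_compose2[OF indep]) auto
    also have "(\<lambda>j \<omega>. (if j = n then f else (\<lambda>y. of_bool (real y < s))) (Y j \<omega>)) = X"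
      by (auto simp: X_def I_def fun_eq_iff)
    finally have indX: "indep_vars (\<lambda>_. borel) X {1..n}" .
    have intX: "integrable M (X j)" if "j \<in> {1..n}" for j
      using f int_I[OF that] by (cases "j = n") (simp_all add: X_def)
    have "(\<Prod>j\<in>{1..n}. expectation (X j)) = expectation (\<lambda>\<omega>. f (Y n \<omega>)) * (\<Prod>j\<in>{1..<n}. expectation (I j))"
      unfolding split by (simp add: X_def)
    also have "(\<Prod>j\<in>{1..<n}. expectation (I j)) = (1 - p) ^ (n - 1)"
      using exp_I by (subst prod.cong[OF refl, of _ _ "\<lambda>_. 1 - p"]) auto
    finally show ?thesis
      using indep_vars_lebesgue_integral[OF _ indX intX] indep_vars_integrable[OF _ indX intX]
      unfolding X by simp
  qed
  have P: "integrable M ?P" "expectation ?P = (1 - p) ^ (n - 1)"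
    using *[of "\<lambda>_. 1"] by (simp_all add: prob_space)
  have YP: "integrable M (\<lambda>\<omega>. real (Y n \<omega>) * ?P \<omega>)"
    "expectation (\<lambda>\<omega>. real (Y n \<omega>) * ?P \<omega>) = expectation (\<lambda>\<omega>. real (Y n \<omega>)) * (1 - p) ^ (n - 1)"
    using *[of real] int n by simp_all
  have "(1 - p) ^ (n - 1) * expectation (\<lambda>\<omega>. real (Y n \<omega>)) + (1 - (1 - p) ^ (n - 1)) * s
      = expectation (\<lambda>\<omega>. real (Y n \<omega>) * ?P \<omega> + (1 - ?P \<omega>) * s)"
    using P YP by (simp add: prob_space)
  also have "\<dots> \<le> expectation (\<lambda>\<omega>. real (MAX j\<in>{1..n}. Y j \<omega>))"
  proof (rule integral_mono)
    show "integrable M (\<lambda>\<omega>. real (Y n \<omega>) * ?P \<omega> + (1 - ?P \<omega>) * s)"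
      using P YP by simp
    show "integrable M (\<lambda>\<omega>. real (MAX j\<in>{1..n}. Y j \<omega>))"
      using n meas int by (intro integrable_real_Max) auto
    fix \<omega>
    have le: "real (Y j \<omega>) \<le> real (MAX j\<in>{1..n}. Y j \<omega>)" if "j \<in> {1..n}" for j
      using that by simp
    show "real (Y n \<omega>) * ?P \<omega> + (1 - ?P \<omega>) * s \<le> real (MAX j\<in>{1..n}. Y j \<omega>)"
    proof (cases "\<forall>j\<in>{1..<n}. real (Y j \<omega>) < s")
      case True
      then have "?P \<omega> = 1" by (intro prod.neutral) (auto simp: I_def)
      then show ?thesis using le[of n] n by simp
    next
      case False
      then obtain j where j: "j \<in> {1..<n}" "s \<le> real (Y j \<omega>)" by force
      then have P0: "?P \<omega> = 0" by (intro prod_zero) (auto simp: I_def intro!: bexI[of _ j])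
      show ?thesis unfolding P0 using order_trans[OF j(2) le[of j]] j(1) by simp
    qed
  qed
  finally show ?thesis .
qed

section \<open>Limits of the bounds as \<open>c\<close> grows\<close>

lemma u_tilde_LIMSEQ: "(\<lambda>c. u_tilde n c) \<longlonglongrightarrow> 1"
  unfolding u_tilde_def by real_asymp

text \<open>The bracket stays in [0, 1] while \<open>sqrt (ln n / c)\<close> tends to 0, so no
  asymptotics of \<open>Q\<close> enter.\<close>

lemma l_tilde_LIMSEQ:
  assumes "n > 0"
  shows "(\<lambda>c. l_tilde n c) \<longlonglongrightarrow> 1"
proof -
  let ?r = "\<lambda>c. (1 - Q (real c) (real c + sqrt (real c * ln (real n)))) ^ (n - 1)"
  have r: "0 \<le> ?r c" "?r c \<le> 1" if "c > 0" for c
    using assms that by (auto intro!: power_le_one zero_le_power simp: Q_le_1 Q_nonneg)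
  have "(\<lambda>c. sqrt (ln (real n) / real c) * (1 - ?r c)) \<longlonglongrightarrow> 0"
  proof (rule tendsto_sandwich[OF _ _ tendsto_const])
    show "\<forall>\<^sub>F c in sequentially. 0 \<le> sqrt (ln (real n) / real c) * (1 - ?r c)"
      using eventually_gt_at_top[of 0]
    proof eventually_elim
      case (elim c)
      then show ?case using r[OF elim] assms by simp
    qed
    show "\<forall>\<^sub>F c in sequentially. sqrt (ln (real n) / real c) * (1 - ?r c) \<le> sqrt (ln (real n) / real c)"
      using eventually_gt_at_top[of 0]
    proof eventually_elim
      case (elim c)
      then show ?case using r[OF elim] assms by (intro mult_left_le) auto
    qed
    have "(\<lambda>c. sqrt (ln (real n) / real c)) \<longlonglongrightarrow> sqrt 0"
      by (intro tendsto_real_sqrt lim_const_over_n)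
    then show "(\<lambda>c. sqrt (ln (real n) / real c)) \<longlonglongrightarrow> 0" by simp
  qed
  from tendsto_add[OF tendsto_const[of 1] this] show ?thesis
    unfolding l_tilde_def by simp
qed

theorem proposition20:
  fixes q :: real
  assumes "0 < q" and "q < 1"
  shows "(\<forall>n>0. \<forall>c>0. \<forall>(M :: 'a measure) (Y :: nat \<Rightarrow> 'a \<Rightarrow> nat).
            prob_space M \<longrightarrow>
            prob_space.indep_vars M (\<lambda>_. count_space UNIV) Y {1..n} \<longrightarrow>
            (\<forall>j\<in>{1..n}. distr M (count_space UNIV) (Y j) = measure_pmf (NegBin c q)) \<longrightarrow>
              1 / phi q * l_tilde n c
                \<le> (\<integral>\<omega>. real (MAX j\<in>{1..n}. Y j \<omega>) \<partial>M) / real c \<and>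
              (\<integral>\<omega>. real (MAX j\<in>{1..n}. Y j \<omega>) \<partial>M) / real c
                \<le> 1 / phi q * (real n * Q (real c + 1) (Q_inv (real c) (1 / real n))) + 1 \<and>
              1 / phi q * (real n * Q (real c + 1) (Q_inv (real c) (1 / real n))) + 1
                \<le> 1 / phi q * u_tilde n c + 1)
       \<and> (\<forall>n>0. (\<lambda>c. l_tilde n c) \<longlonglongrightarrow> 1 \<and> (\<lambda>c. u_tilde n c) \<longlonglongrightarrow> 1)"
proof (intro conjI allI impI)
  fix n c :: nat and M :: "'a measure" and Y :: "nat \<Rightarrow> 'a \<Rightarrow> nat"
  assume n: "0 < n" and c: "0 < c" and M: "prob_space M"
    and indep: "prob_space.indep_vars M (\<lambda>_. count_space UNIV) Y {1..n}"
    and law: "\<forall>j\<in>{1..n}. distr M (count_space UNIV) (Y j) = measure_pmf (NegBin c q)"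
  interpret prob_space M by fact
  let ?max = "\<lambda>\<omega>. real (MAX j\<in>{1..n}. Y j \<omega>)"
  have pos: "phi q > 0" using assms by (rule phi_pos)
  have meas: "Y j \<in> measurable M (count_space UNIV)" if "j \<in> {1..n}" for j
    using indep that by (auto simp: indep_vars_def)
  have transfer: "expectation (\<lambda>\<omega>. f (Y j \<omega>)) = measure_pmf.expectation (NegBin c q) f"
    if "j \<in> {1..n}" for j and f :: "nat \<Rightarrow> real"
    using law that meas[OF that] by (subst integral_distr[symmetric, of "Y j" _ "count_space UNIV"]) auto
  have int: "integrable M (\<lambda>\<omega>. real (Y j \<omega>))" if "j \<in> {1..n}" for j
    using law that integrable_NegBin[OF assms c] integrable_distr_eq[OF meas[OF that], of real] by simp

  show "1 / phi q * l_tilde n c \<le> expectation ?max / real c"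
  proof -
    define t where "t = real c + sqrt (real c * ln (real n))"
    define p where "p = measure_pmf.prob (NegBin c q) {y. t / phi q \<le> real y}"
    have t: "t \<ge> real c" using n by (simp add: t_def)
    have tail: "prob {\<omega> \<in> space M. t / phi q \<le> real (Y j \<omega>)} = p" if "j \<in> {1..n}" for j
    proof -
      have "p = measure (distr M (count_space UNIV) (Y j)) {y. t / phi q \<le> real y}"
        using law that by (simp add: p_def)
      also have "\<dots> = prob {\<omega> \<in> space M. t / phi q \<le> real (Y j \<omega>)}"
        using meas[OF that] by (subst measure_distr) (auto intro!: arg_cong[where f = prob])
      finally show ?thesis by simp
    qed
    \<comment> \<open>The true tail \<open>p\<close> dominates the Gamma tail, so replacing the
      latter by \<open>p\<close> in \<open>l_tilde\<close> can only increase it.\<close>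
    have p: "Q (real c) t \<le> p" "p \<le> 1"
      unfolding p_def using t by (auto intro!: NegBin_tail_ge assms c)
    define r where "r = (1 - p) ^ (n - 1)"
    have r: "0 \<le> r" "r \<le> (1 - Q (real c) t) ^ (n - 1)"
      unfolding r_def using p by (auto intro!: power_mono)
    have "sqrt (real c * ln (real n)) = real c * sqrt (ln (real n) / real c)"
      using c by (simp add: real_sqrt_mult real_sqrt_divide field_simps)
    then have tc: "t = real c * (1 + sqrt (ln (real n) / real c))"
      by (simp add: t_def distrib_left)
    have "l_tilde n c \<le> 1 + sqrt (ln (real n) / real c) * (1 - r)"
      unfolding l_tilde_def t_def[symmetric] using r n by (intro add_left_mono mult_left_mono) auto
    \<comment> \<open>Rewritten as a convex combination of \<open>c\<close> and \<open>t\<close>;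
      after division by \<open>phi q\<close> these are the lower bound for the mean and the level in
      \<open>expectation_Max_ge\<close>.\<close>
    also have "\<dots> = (r * real c + (1 - r) * t) / real c"
      using c by (simp add: tc field_simps)
    finally have "1 / phi q * l_tilde n c \<le> 1 / phi q * ((r * real c + (1 - r) * t) / real c)"
      using pos by (intro mult_left_mono) auto
    also have "\<dots> = (r * (real c / phi q) + (1 - r) * (t / phi q)) / real c"
      using pos c by (simp add: field_simps)
    also have "\<dots> \<le> (r * expectation (\<lambda>\<omega>. real (Y n \<omega>)) + (1 - r) * (t / phi q)) / real c"
      using r expectation_NegBin_ge[OF assms c] transfer[of n real] n
      by (intro divide_right_mono add_right_mono mult_left_mono) auto
    also have "\<dots> \<le> expectation ?max / real c"
      unfolding r_def using expectation_Max_ge[OF n indep int tail] by (intro divide_right_mono) auto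
    finally show ?thesis .
  qed

  define x where "x = Q_inv (real c) (1 / real n)"
  have x: "Q (real c) x = 1 / real n" "x \<ge> 0"
    unfolding x_def using n c by (intro Q_Q_inv; simp)+
  show "expectation ?max / real c \<le> 1 / phi q * (real n * Q (real c + 1) (Q_inv (real c) (1 / real n))) + 1"
  proof -
    define b where "b = (real c * Q (real c + 1) x - x * Q (real c) x) / phi q"
    have "expectation (\<lambda>\<omega>. max 0 (real (Y j \<omega>) - (real c + x / phi q))) \<le> b" if "j \<in> {1..n}" for j
      unfolding b_def using NegBin_excess_le[OF assms c x(2)]
        transfer[OF that, of "\<lambda>y. max 0 (real y - (real c + x / phi q))"] by simp
    then have "expectation ?max \<le> (real c + x / phi q) + real (card {1..n}) * b"
      using n meas int by (intro expectation_Max_le) auto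
    \<comment> \<open>Since \<open>Q c x = 1 / n\<close>, the \<open>n\<close> excess bounds
      contribute \<open>- x / phi q\<close>, which cancels the same term in the threshold.\<close>
    also have "\<dots> = real c * (1 / phi q * (real n * Q (real c + 1) x) + 1)"
      using pos n by (simp add: b_def x field_simps)
    finally show ?thesis
      using c by (simp add: x_def field_simps)
  qed
  show "1 / phi q * (real n * Q (real c + 1) (Q_inv (real c) (1 / real n))) + 1 \<le> 1 / phi q * u_tilde n c + 1"
    using Q_Suc_Q_inv_le[OF n c] pos by (intro add_right_mono mult_left_mono) auto
qed (auto intro: l_tilde_LIMSEQ u_tilde_LIMSEQ)

end
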